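(* Let $K\subseteq\mathbb{R}^n$ be a closed set, $h:\mathbb{R}^n\to\mathbb{R}\cup\{\pm\infty\}$ a proper lower semicontinuous function such that $K\subseteq\operatorname{dom}h$, and $\beta>0$. Suppose that $\overline{x}\in\operatorname{argmin}_K h$ and that $K$ is star-shaped at $\overline{x}$. If $h$ is strongly star quasiconvex on $K$ with modulus $\gamma>0$, then $$\operatorname{Fix}\big(\operatorname{Prox}_{\beta h}(K,\cdot)\big)=\tfrac{\gamma}{4}\text{-}\operatorname{argmin}_K h.$$
   Context: $h$ is proper if $\operatorname{dom}h:=\{x: h(x)<+\infty\}\ne\emptyset$ and $h>-\infty$ everywhere. $K$ is star-shaped at $\overline{x}\in K$ if $[\overline{x},x]\subseteq K$ for every $x\in K$. $h$ is strongly star quasiconvex on $K$ with modulus $\gamma>0$ if, with $\overline{x}\in\operatorname{argmin}_K h$ (the minimizer over $K$, then unique), for every $y\in K$ and $\lambda\in[0,1]$, $$h(\lambda\overline{x}+(1-\lambda)y)\le h(y)-\lambda(1-\lambda)\frac{\gamma}{2}\|y-\overline{x}\|^2.$$ $\operatorname{Prox}_{\beta h}(K,z):=\operatorname{argmin}_{y\in K}\{h(y)+\frac{1}{2\beta}\|y-z\|^2\}$ (set-valued), and $\operatorname{Fix}(\operatorname{Prox}_{\beta h}(K,\cdot)):=\{x\in\mathbb{R}^n: x\in\operatorname{Prox}_{\beta h}(K,x)\}$. $\frac{\gamma}{4}\text{-}\operatorname{argmin}_K h:=\{x\in K: h(x)+\frac{\gamma}{4}\|y-x\|^2\le h(y)\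 \text{for all } y\in K\}$. *)

theory Defs
  imports "HOL-Analysis.Analysis"
begin

definition edom :: "('a \<Rightarrow> ereal) \<Rightarrow> 'a set" where
  "edom h = {x. h x < \<infinity>}"

definition proper :: "('a \<Rightarrow> ereal) \<Rightarrow> bool" where
  "proper h \<longleftrightarrow> edom h \<noteq> {} \<and> (\<forall>x. h x > -\<infinity>)"

(* The punctured filter is used here; since h x itself is the lower bound,
   the non-punctured version of the inequality is equivalent. *)
definition lower_semicont :: "('a::topological_space \<Rightarrow> ereal) \<Rightarrow> bool" where
  "lower_semicont h \<longleftrightarrow> (\<forall>x. h x \<le> Liminf (at x) h)"

definition star_shaped_at :: "'a::real_vector set \<Rightarrow> 'a \<Rightarrow> bool" where
  "star_shaped_at K x0 \<longleftrightarrow> x0 \<in> K \<and> (\<forall>x\<in>K. closed_segment x0 x \<subseteq> K)"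

definition argmin_on :: "'a set \<Rightarrow> ('a \<Rightarrow> ereal) \<Rightarrow> 'a set" where
  "argmin_on K h = {x. is_arg_min h (\<lambda>y. y \<in> K) x}"

(* If h is finite on K and K is star-shaped at some minimizer, the inequality forces that
   minimizer to be unique, so the existential quantifier denotes "the" minimizer.
   The subtracted term is real, so the subtraction in ereal is always well behaved. *)
definition strongly_star_quasiconvex_on ::
    "'a::real_normed_vector set \<Rightarrow> ('a \<Rightarrow> ereal) \<Rightarrow> real \<Rightarrow> bool" where
  "strongly_star_quasiconvex_on K h \<gamma> \<longleftrightarrow> \<gamma> > 0 \<and>
     (\<exists>x0\<in>argmin_on K h. \<forall>y\<in>K. \<forall>l\<in>{0..1}.
        h (l *\<^sub>R x0 + (1 - l) *\<^sub>R y)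
          \<le> h y - ereal (l * (1 - l) * (\<gamma> / 2) * (norm (y - x0))\<^sup>2))"

definition Prox ::
    "real \<Rightarrow> ('a::real_normed_vector \<Rightarrow> ereal) \<Rightarrow> 'a set \<Rightarrow> 'a \<Rightarrow> 'a set" where
  "Prox \<beta> h K z = argmin_on K (\<lambda>y. h y + ereal (1 / (2 * \<beta>) * (norm (y - z))\<^sup>2))"

definition Fix :: "('a \<Rightarrow> 'a set) \<Rightarrow> 'a set" where
  "Fix T = {x. x \<in> T x}"

(* For c = \<gamma>/4 this is the set written \<gamma>/4-argmin of h over K. *)
definition strong_argmin_on ::
    "real \<Rightarrow> 'a::real_normed_vector set \<Rightarrow> ('a \<Rightarrow> ereal) \<Rightarrow> 'a set" where
  "strong_argmin_on c K h = {x\<in>K. \<forall>y\<in>K. h x + ereal (c * (norm (y - x))\<^sup>2) \<le> h y}"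

end

theory Submission
  imports Defs
begin

text \<open>Both sets are equal to \<open>{xbar}\<close>. If \<open>x\<close> is a fixed point, compare it with
  \<open>l xbar + (1 - l) x\<close>: strong star quasiconvexity gains a term of order \<open>l\<close>, while the proximal
  penalty costs only order \<open>l\<^sup>2\<close>, so \<open>x = xbar\<close>. That \<open>xbar\<close> is a \<open>\<gamma>/4\<close>-minimizer does not follow
  from a single use of the inequality (the best choice \<open>l = 1/2\<close> only gives \<open>\<gamma>/8\<close>); one iterates
  the contraction towards \<open>xbar\<close> by a factor \<open>q < 1\<close> and sums the resulting geometric series,
  which gives the constant \<open>q / (1 + q) * \<gamma> / 2\<close>, and then lets \<open>q\<close> tend to \<open>1\<close>.\<close>

text \<open>Contracting by \<open>q\<close> lowers \<open>f\<close> by at least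
  \<open>(1 - q) * q * (\<gamma> / 2)\<close> times the squared distance to \<open>x0\<close>, and
  multiplies that squared distance by \<open>q\<^sup>2\<close>. The guaranteed decreases thus form a
  geometric series of ratio \<open>q\<^sup>2\<close>; the factor in front is its partial sum after
  \<open>n\<close> contractions. The induction peels off the first contraction, hence
  \<open>y\<close> is arbitrary.\<close>

lemma star_quasiconvex_growth_step:
  fixes f :: "'a::real_normed_vector \<Rightarrow> real"
  assumes star: "star_shaped_at K x0"
    and min: "\<And>y. y \<in> K \<Longrightarrow> f x0 \<le> f y"
    and qc: "\<And>y l. y \<in> K \<Longrightarrow> 0 \<le> l \<Longrightarrow> l \<le> 1 \<Longrightarrow>
      f (l *\<^sub>R x0 + (1 - l) *\<^sub>R y) \<le> f y - l * (1 - l) * (\<gamma> / 2) * (norm (y - x0))\<^sup>2"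
    and q: "0 \<le> q" "q \<le> 1" and y: "y \<in> K"
  shows "f x0 + (1 - (q\<^sup>2) ^ n) * (q / (1 + q)) * (\<gamma> / 2) * (norm (y - x0))\<^sup>2 \<le> f y"
  using y
proof (induction n arbitrary: y)
  case 0
  then show ?case using min by simp
next
  case (Suc n)
  define z where "z = (1 - q) *\<^sub>R x0 + q *\<^sub>R y"
  have "z \<in> closed_segment x0 y"
    unfolding z_def closed_segment_def using q by auto
  then have zK: "z \<in> K"
    using star Suc.prems by (auto simp: star_shaped_at_def)
  have "z - x0 = q *\<^sub>R (y - x0)"
    by (simp add: z_def algebra_simps)
  then have nz: "(norm (z - x0))\<^sup>2 = q\<^sup>2 * (norm (y - x0))\<^sup>2"
    by (simp add: power_mult_distrib)
  have "f z \<le> f y - (1 - q) * q * (\<gamma> / 2) * (norm (y - x0))\<^sup>2"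
    using qc[OF Suc.prems, of "1 - q"] q by (simp add: z_def)
  moreover have "f x0 + (1 - (q\<^sup>2) ^ n) * (q / (1 + q)) * (\<gamma> / 2) * (q\<^sup>2 * (norm (y - x0))\<^sup>2) \<le> f z"
    using Suc.IH[OF zK] nz by simp
  moreover have "(1 - (q\<^sup>2) ^ Suc n) * (q / (1 + q)) * (\<gamma> / 2) * (norm (y - x0))\<^sup>2
    = (1 - (q\<^sup>2) ^ n) * (q / (1 + q)) * (\<gamma> / 2) * (q\<^sup>2 * (norm (y - x0))\<^sup>2)
      + (1 - q) * q * (\<gamma> / 2) * (norm (y - x0))\<^sup>2"
  proof -
    have telescope: "(1 - a * b) * c * g * d = (1 - b) * c * g * (a * d) + e * g * d"
      if "e = (1 - a) * c" for a b c d e g :: real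
      unfolding that by (simp add: algebra_simps)
    \<comment> \<open>One contraction gains the fraction \<open>1 - q\<^sup>2\<close> of the limit
      constant \<open>q / (1 + q)\<close>, which is what makes the sum telescope.\<close>
    have "(1 - q) * q = (1 - q\<^sup>2) * (q / (1 + q))"
      using q by (simp add: field_simps power2_eq_square)
    then show ?thesis unfolding power_Suc by (rule telescope)
  qed
  ultimately show ?case by linarith
qed

text \<open>The order of limits matters: at \<open>q = 1\<close> the partial sums vanish, so
  \<open>n\<close> goes to infinity first with \<open>q < 1\<close> fixed. Only then does
  \<open>q\<close> tend to 1, where \<open>q / (1 + q)\<close> tends to 1/2 and yields
  \<gamma>/4.\<close>

lemma star_quasiconvex_growth:
  fixes f :: "'a::real_normed_vector \<Rightarrow> real"
  assumes star: "star_shaped_at K x0"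
    and min: "\<And>y. y \<in> K \<Longrightarrow> f x0 \<le> f y"
    and qc: "\<And>y l. y \<in> K \<Longrightarrow> 0 \<le> l \<Longrightarrow> l \<le> 1 \<Longrightarrow>
      f (l *\<^sub>R x0 + (1 - l) *\<^sub>R y) \<le> f y - l * (1 - l) * (\<gamma> / 2) * (norm (y - x0))\<^sup>2"
    and y: "y \<in> K"
  shows "f x0 + \<gamma> / 4 * (norm (y - x0))\<^sup>2 \<le> f y"
proof -
  define D where "D = (norm (y - x0))\<^sup>2"
  have lim_n: "f x0 + q / (1 + q) * (\<gamma> / 2) * D \<le> f y" if "0 \<le> q" "q < 1" for q
  proof (rule LIMSEQ_le_const2)
    have "norm (q\<^sup>2) < 1"
      using that abs_square_less_1[of q] by simp
    then have "(\<lambda>n. f x0 + (1 - (q\<^sup>2) ^ n) * (q / (1 + q)) * (\<gamma> / 2) * D)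
        \<longlonglongrightarrow> f x0 + (1 - 0) * (q / (1 + q)) * (\<gamma> / 2) * D"
      by (intro tendsto_intros)
    then show "(\<lambda>n. f x0 + (1 - (q\<^sup>2) ^ n) * (q / (1 + q)) * (\<gamma> / 2) * D)
        \<longlonglongrightarrow> f x0 + q / (1 + q) * (\<gamma> / 2) * D"
      by simp
    show "\<exists>N. \<forall>n\<ge>N. f x0 + (1 - (q\<^sup>2) ^ n) * (q / (1 + q)) * (\<gamma> / 2) * D \<le> f y"
      unfolding D_def using star_quasiconvex_growth_step[OF star min qc _ _ y] that by force
  qed
  have "((\<lambda>q. f x0 + q / (1 + q) * (\<gamma> / 2) * D) \<longlongrightarrow> f x0 + 1 / (1 + 1) * (\<gamma> / 2) * D) (at_left 1)"
    by (intro tendsto_intros) simp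
  moreover have "\<forall>\<^sub>F q in at_left 1. f x0 + q / (1 + q) * (\<gamma> / 2) * D \<le> f y"
    by (rule eventually_mono[OF eventually_at_left_real[OF zero_less_one]]) (use lim_n in simp)
  ultimately have "f x0 + 1 / (1 + 1) * (\<gamma> / 2) * D \<le> f y"
    by (rule tendsto_upperbound) simp
  then show ?thesis by (simp add: D_def)
qed

text \<open>Here \<open>c\<close> stands for the proximal weight
  \<open>1 / (2 * \<beta>)\<close>.\<close>

lemma star_quasiconvex_prox_fixed:
  fixes f :: "'a::real_normed_vector \<Rightarrow> real"
  assumes star: "star_shaped_at K x0"
    and qc: "\<And>y l. y \<in> K \<Longrightarrow> 0 \<le> l \<Longrightarrow> l \<le> 1 \<Longrightarrow>
      f (l *\<^sub>R x0 + (1 - l) *\<^sub>R y) \<le> f y - l * (1 - l) * (\<gamma> / 2) * (norm (y - x0))\<^sup>2"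
    and \<gamma>: "\<gamma> > 0" and x: "x \<in> K"
    and fixed: "\<And>y. y \<in> K \<Longrightarrow> f x \<le> f y + c * (norm (y - x))\<^sup>2"
  shows "x = x0"
proof (rule ccontr)
  assume "x \<noteq> x0"
  define D where "D = (norm (x - x0))\<^sup>2"
  have D: "D > 0" using \<open>x \<noteq> x0\<close> by (simp add: D_def)
  have ineq: "(1 - l) * (\<gamma> / 2) \<le> l * c" if l: "0 < l" "l < 1" for l
  proof -
    define z where "z = l *\<^sub>R x0 + (1 - l) *\<^sub>R x"
    \<comment> \<open>\<open>closed_segment\<close> puts its parameter on the second endpoint, so
      the witness is \<open>1 - l\<close>.\<close>
    have "z = (1 - (1 - l)) *\<^sub>R x0 + (1 - l) *\<^sub>R x" by (simp add: z_def)
    then have "z \<in> closed_segment x0 x"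
      unfolding closed_segment_def using l by fastforce
    then have zK: "z \<in> K"
      using star x by (auto simp: star_shaped_at_def)
    have "z - x = l *\<^sub>R (x0 - x)"
      by (simp add: z_def algebra_simps)
    then have "(norm (z - x))\<^sup>2 = l\<^sup>2 * D"
      by (simp add: D_def power_mult_distrib norm_minus_commute)
    then have "l * (1 - l) * (\<gamma> / 2) * D \<le> c * (l\<^sup>2 * D)"
      using fixed[OF zK] qc[OF x, of l] l unfolding z_def D_def by simp
    \<comment> \<open>Cancelling \<open>l * D > 0\<close> leaves an inequality whose limit at
      \<open>l = 0\<close> reads \<gamma>/2 \<le> 0.\<close>
    then have "(l * D) * ((1 - l) * (\<gamma> / 2)) \<le> (l * D) * (l * c)"
      by (simp add: power2_eq_square mult_ac)
    then show ?thesis using l D by simp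
  qed
  have "((\<lambda>l. (1 - l) * (\<gamma> / 2)) \<longlongrightarrow> (1 - 0) * (\<gamma> / 2)) (at_right 0)"
    by (intro tendsto_intros)
  moreover have "((\<lambda>l. l * c) \<longlongrightarrow> 0 * c) (at_right 0)"
    by (intro tendsto_intros)
  moreover have "\<forall>\<^sub>F l in at_right 0. (1 - l) * (\<gamma> / 2) \<le> l * c"
    by (rule eventually_mono[OF eventually_at_right_real[OF zero_less_one]]) (use ineq in simp)
  ultimately have "(1 - 0) * (\<gamma> / 2) \<le> 0 * c"
    by (intro tendsto_le[OF trivial_limit_at_right_real])
  then show False using \<gamma> by simp
qed

lemma in_argmin_on_iff:
  fixes h :: "'a \<Rightarrow> ereal"
  shows "x \<in> argmin_on K h \<longleftrightarrow> x \<in> K \<and> (\<forall>y\<in>K. h x \<le> h y)"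
  by (auto simp: argmin_on_def is_arg_min_linorder)

theorem proposition25:
  fixes K :: "(real ^ 'n) set" and h :: "real ^ 'n \<Rightarrow> ereal"
    and \<beta> \<gamma> :: real and xbar :: "real ^ 'n"
  assumes "closed K"
    and "proper h"
    and "lower_semicont h"
    and "K \<subseteq> edom h"
    and "\<beta> > 0"
    and "xbar \<in> argmin_on K h"
    and "star_shaped_at K xbar"
    and "\<gamma> > 0"
    and "strongly_star_quasiconvex_on K h \<gamma>"
  shows "Fix (Prox \<beta> h K) = strong_argmin_on (\<gamma> / 4) K h"
proof -
  \<comment> \<open>\<open>f\<close> agrees with \<open>h\<close> only where \<open>h\<close> is
    finite, so \<open>f\<close> is evaluated only at points known to lie in
    \<open>K\<close>.\<close>
  define f where "f = (\<lambda>x. real_of_ereal (h x))"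
  have hf: "h x = ereal (f x)" if "x \<in> K" for x
  proof -
    have "h x < \<infinity>" "- \<infinity> < h x"
      using that assms(2,4) by (auto simp: proper_def edom_def)
    then show ?thesis unfolding f_def by (cases "h x") auto
  qed
  have xK: "xbar \<in> K" and min: "\<And>y. y \<in> K \<Longrightarrow> f xbar \<le> f y"
    using assms(6) hf by (auto simp: in_argmin_on_iff)
  obtain x0 where x0K: "x0 \<in> K" and x0qc: "\<And>y l. y \<in> K \<Longrightarrow> 0 \<le> l \<Longrightarrow> l \<le> 1 \<Longrightarrow>
      h (l *\<^sub>R x0 + (1 - l) *\<^sub>R y) \<le> h y - ereal (l * (1 - l) * (\<gamma> / 2) * (norm (y - x0))\<^sup>2)"
  proof -
    from assms(9) obtain x0 where "x0 \<in> argmin_on K h"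
      and qc0: "\<forall>y\<in>K. \<forall>l\<in>{0..1}. h (l *\<^sub>R x0 + (1 - l) *\<^sub>R y)
        \<le> h y - ereal (l * (1 - l) * (\<gamma> / 2) * (norm (y - x0))\<^sup>2)"
      unfolding strongly_star_quasiconvex_on_def by blast
    show thesis
    proof (rule that)
      show "x0 \<in> K" using \<open>x0 \<in> argmin_on K h\<close> by (simp add: in_argmin_on_iff)
    qed (use qc0 in simp)
  qed
  have seg: "l *\<^sub>R xbar + (1 - l) *\<^sub>R y \<in> K" if "y \<in> K" "0 \<le> l" "l \<le> 1" for y l
  proof -
    have "l *\<^sub>R xbar + (1 - l) *\<^sub>R y \<in> closed_segment xbar y"
      unfolding closed_segment_def using that by (auto intro: exI[of _ "1 - l"])
    then show ?thesis using assms(7) that by (auto simp: star_shaped_at_def)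
  qed
  \<comment> \<open>The minimizer hidden in the definition could differ from \<open>xbar\<close>. At
    the midpoint, which lies in \<open>K\<close> by star-shapedness at \<open>xbar\<close>,
    quasiconvexity would push \<open>f\<close> below the minimum by \<gamma>/8 times the squared
    distance.\<close>
  have "x0 = xbar"
  proof -
    let ?m = "(1/2) *\<^sub>R x0 + (1 - 1/2) *\<^sub>R xbar"
    have mK: "?m \<in> K"
      using seg[OF x0K, of "1/2"] by (simp add: add.commute)
    have "f ?m \<le> f xbar - 1/2 * (1 - 1/2) * (\<gamma> / 2) * (norm (xbar - x0))\<^sup>2"
      using x0qc[OF xK, of "1/2"] hf[OF mK] hf[OF xK] by simp
    with min[OF mK] have "\<gamma> * (norm (xbar - x0))\<^sup>2 \<le> 0" by simp
    then show ?thesis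
      using assms(8) by (simp add: mult_le_0_iff)
  qed
  then have qc: "f (l *\<^sub>R xbar + (1 - l) *\<^sub>R y)
      \<le> f y - l * (1 - l) * (\<gamma> / 2) * (norm (y - xbar))\<^sup>2"
    if "y \<in> K" "0 \<le> l" "l \<le> 1" for y l
    using x0qc[OF that] hf[OF seg[OF that]] hf[OF that(1)] by simp
  have fix_iff: "x \<in> Fix (Prox \<beta> h K) \<longleftrightarrow>
      x \<in> K \<and> (\<forall>y\<in>K. f x \<le> f y + 1 / (2 * \<beta>) * (norm (y - x))\<^sup>2)" for x
    by (auto simp: Fix_def Prox_def in_argmin_on_iff hf)
  have strong_iff: "x \<in> strong_argmin_on (\<gamma> / 4) K h \<longleftrightarrow>
      x \<in> K \<and> (\<forall>y\<in>K. f x + \<gamma> / 4 * (norm (y - x))\<^sup>2 \<le> f y)" for x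
    by (auto simp: strong_argmin_on_def hf)
  have "Fix (Prox \<beta> h K) = {xbar}"
  proof (intro equalityI subsetI)
    fix x assume "x \<in> Fix (Prox \<beta> h K)"
    then show "x \<in> {xbar}"
      using star_quasiconvex_prox_fixed[OF assms(7) qc assms(8)] unfolding fix_iff by blast
  next
    fix x assume "x \<in> {xbar}"
    then show "x \<in> Fix (Prox \<beta> h K)"
      using xK min assms(5) by (auto simp: fix_iff intro!: add_increasing2)
  qed
  moreover have "strong_argmin_on (\<gamma> / 4) K h = {xbar}"
  proof (intro equalityI subsetI)
    fix x assume "x \<in> strong_argmin_on (\<gamma> / 4) K h"
    \<comment> \<open>Testing against \<open>xbar\<close> itself leaves no room for a positive
      quadratic term.\<close>
    then have "x \<in> K" "f x + \<gamma> / 4 * (norm (xbar - x))\<^sup>2 \<le> f xbar"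
      using xK by (auto simp: strong_iff)
    with min[of x] have "\<gamma> * (norm (xbar - x))\<^sup>2 \<le> 0" by simp
    then show "x \<in> {xbar}"
      using assms(8) by (simp add: mult_le_0_iff)
  next
    fix x assume "x \<in> {xbar}"
    then show "x \<in> strong_argmin_on (\<gamma> / 4) K h"
      using xK star_quasiconvex_growth[OF assms(7) min qc] by (auto simp: strong_iff)
  qed
  ultimately show ?thesis by simp
qed

end
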